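(* Up to isomorphism, the graphs $B_1,B_2,B_3$ and their complements $\overline{B_1},\overline{B_2},\overline{B_3}$ are all the non-split prime graphs $G$ with $\deg(G)=4$.
   Context: Graphs are finite and simple, with nonempty vertex set; $\overline{G}$ is the complement of $G$. A 2-switch on $G$: given four distinct vertices $a,b,x,y$ with $ab,xy\in E(G)$ and $ax,by\notin E(G)$, delete the edges $ab,xy$ and add the edges $ax,by$ (two 2-switches are equal iff they delete the same two edges and add the same two edges). The 2-switch-degree $\deg(G)$ is the number of distinct 2-switches that can be performed on $G$. A vertex is active in $G$ if it is one of the four vertices involved in some 2-switch on $G$; $G$ is active if all its vertices are active. A split graph is a graph whose vertex set can be partitioned into a clique $K$ and an independent set $I$ (either possibly empty); when such a bipartition is fixed one writes $(S,K,I)$. If $(S,K,I)$ is split and $G$ is a graph vertex-disjoint from $S$, the Tyshkevich composition $(S,K,I)\circ G$ has vertex set $V(S)\cup V(G)$ and edge set $E(S)\cup E(G)\cup\{xy: x\in K,\ y\in V(G)\}$. A graph $G$ is decomposable if $G=S\circ H$ for some $S,H$ with $|S|,|H|\ge1$, and indecomposable otherwise. A graph is prime if it is indecomposable and active. For $j\in\{1,2,3\}$, $B_j$ is the graph with vertex set $\{v,c_0,c_1,c_2,c_3\}$ in which $c_0c_1c_2c_3c_0$ is an induced 4-cycle and the neighborhood of $v$ is $\{c_0,\dots,c_{j-1}\}$. *)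

theory Defs
  imports Main
begin

record 'a ugraph =
  verts :: "'a set"
  edges :: "'a set set"

definition simple_graph :: "'a ugraph \<Rightarrow> bool" where
  "simple_graph G \<longleftrightarrow>
     finite (verts G) \<and> verts G \<noteq> {} \<and> (\<forall>e\<in>edges G. e \<subseteq> verts G \<and> card e = 2)"

definition complement :: "'a ugraph \<Rightarrow> 'a ugraph" where
  "complement G =
     \<lparr> verts = verts G, edges = {e. e \<subseteq> verts G \<and> card e = 2 \<and> e \<notin> edges G} \<rparr>"

definition graph_iso :: "'a ugraph \<Rightarrow> 'b ugraph \<Rightarrow> bool" where
  "graph_iso G H \<longleftrightarrow>
     (\<exists>f. bij_betw f (verts G) (verts H) \<and>
          (\<forall>u\<in>verts G. \<forall>w\<in>verts G. {u, w} \<in> edges G \<longleftrightarrow> {f u, f w} \<in> edges H))"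

definition can_switch :: "'a ugraph \<Rightarrow> 'a \<Rightarrow> 'a \<Rightarrow> 'a \<Rightarrow> 'a \<Rightarrow> bool" where
  "can_switch G a b x y \<longleftrightarrow>
     distinct [a, b, x, y] \<and> {a, b} \<in> edges G \<and> {x, y} \<in> edges G \<and>
     {a, x} \<notin> edges G \<and> {b, y} \<notin> edges G"

text \<open>A 2-switch is identified with the pair (deleted edges, added edges), so that
  the several quadruples describing the same 2-switch are counted once.\<close>

definition two_switches :: "'a ugraph \<Rightarrow> ('a set set \<times> 'a set set) set" where
  "two_switches G =
     {({{a, b}, {x, y}}, {{a, x}, {b, y}}) | a b x y. can_switch G a b x y}"

definition two_switch_degree :: "'a ugraph \<Rightarrow> nat" where
  "two_switch_degree G = card (two_switches G)"

definition active_vertex :: "'a ugraph \<Rightarrow> 'a \<Rightarrow> bool" where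
  "active_vertex G v \<longleftrightarrow> (\<exists>a b x y. can_switch G a b x y \<and> v \<in> {a, b, x, y})"

definition active_graph :: "'a ugraph \<Rightarrow> bool" where
  "active_graph G \<longleftrightarrow> (\<forall>v\<in>verts G. active_vertex G v)"

definition clique :: "'a ugraph \<Rightarrow> 'a set \<Rightarrow> bool" where
  "clique G K \<longleftrightarrow> (\<forall>u\<in>K. \<forall>w\<in>K. u \<noteq> w \<longrightarrow> {u, w} \<in> edges G)"

definition independent :: "'a ugraph \<Rightarrow> 'a set \<Rightarrow> bool" where
  "independent G I \<longleftrightarrow> (\<forall>u\<in>I. \<forall>w\<in>I. {u, w} \<notin> edges G)"

definition split_bipartition :: "'a ugraph \<Rightarrow> 'a set \<Rightarrow> 'a set \<Rightarrow> bool" where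
  "split_bipartition S K I \<longleftrightarrow>
     K \<union> I = verts S \<and> K \<inter> I = {} \<and> clique S K \<and> independent S I"

definition split_graph :: "'a ugraph \<Rightarrow> bool" where
  "split_graph S \<longleftrightarrow> (\<exists>K I. split_bipartition S K I)"

text \<open>The composition of a bipartitioned split graph \<open>(S, K, I)\<close> with \<open>H\<close>; the
  set \<open>I\<close> does not occur in it, being determined by \<open>S\<close> and \<open>K\<close>.\<close>

definition tyshkevich :: "'a ugraph \<Rightarrow> 'a set \<Rightarrow> 'a ugraph \<Rightarrow> 'a ugraph" where
  "tyshkevich S K H =
     \<lparr> verts = verts S \<union> verts H,
       edges = edges S \<union> edges H \<union> {{x, y} | x y. x \<in> K \<and> y \<in> verts H} \<rparr>"

text \<open>Both factors have at least one vertex, since \<open>simple_graph\<close> excludes the empty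
  vertex set.\<close>

definition decomposable :: "'a ugraph \<Rightarrow> bool" where
  "decomposable G \<longleftrightarrow>
     (\<exists>S K I H. simple_graph S \<and> split_bipartition S K I \<and> simple_graph H \<and>
        verts S \<inter> verts H = {} \<and> G = tyshkevich S K H)"

definition prime_graph :: "'a ugraph \<Rightarrow> bool" where
  "prime_graph G \<longleftrightarrow> \<not> decomposable G \<and> active_graph G"

text \<open>The vertex \<open>i < 4\<close> stands for \<open>c\<^sub>i\<close>, the vertex \<open>4\<close> for \<open>v\<close>.\<close>

definition B :: "nat \<Rightarrow> nat ugraph" where
  "B j =
     \<lparr> verts = {0, 1, 2, 3, 4},
       edges = {{0, 1}, {1, 2}, {2, 3}, {3, 0}} \<union> {{4, i} | i. i < j} \<rparr>"

end

theory Submission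
  imports Defs
begin

text \<open>
  Four vertices carry a 2-switch exactly when they induce \<open>C\<^sub>4\<close>, \<open>2K\<^sub>2\<close> or \<open>P\<^sub>4\<close>; the first two
  carry two switches each, the path carries one. Complementation exchanges deleted and added
  edges of a switch, so it preserves the degree, and it also preserves activity,
  indecomposability and being split. It exchanges \<open>C\<^sub>4\<close> with \<open>2K\<^sub>2\<close>.

  A non-split graph contains an induced \<open>C\<^sub>4\<close>, \<open>2K\<^sub>2\<close> or \<open>C\<^sub>5\<close> (the theorem of Foeldes and Hammer,
  \<open>not_split_induced_cycle\<close>). An induced \<open>C\<^sub>5\<close> contains five paths and so has already five
  switches. Hence a non-split graph of degree 4 or its complement contains an induced 4-cycle
  \<open>C\<close>, which accounts for two switches. Consider a vertex \<open>v\<close> outside \<open>C\<close>.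

  \<^item> If the neighbours of \<open>v\<close> on \<open>C\<close> are two opposite vertices, then \<open>C\<close> and \<open>v\<close> induce
    \<open>K\<^sub>2\<^sub>,\<^sub>3\<close>, which has three 4-cycles and hence six switches: too many.
  \<^item> If \<open>v\<close> has one to three neighbours on \<open>C\<close> in any other position, then \<open>C\<close> and \<open>v\<close> induce some
    \<open>B\<^sub>j\<close>. This has four switches, so they are all the switches of the graph, and since every
    vertex is active there are no further vertices (\<open>induced_B_verts_eq\<close>).
  \<^item> Suppose that every vertex outside \<open>C\<close> is adjacent to all of \<open>C\<close> or to none of it. The former
    vertices form a clique and the latter an independent set, since otherwise there are more than
    four switches. So the graph is \<open>C\<close> itself, with only two switches, or it is a
    Tyshkevich composition with right factor \<open>C\<close>.

  Conversely, the switches of \<open>B\<^sub>j\<close> are listed by \<open>B_switches\<close>. The graph is indecomposable because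
  a switch never mixes vertices of the two factors of a composition (\<open>switch_within_factor\<close>), while
  the 4-cycle and a switch that moves an edge at \<open>v\<close> overlap and together cover all vertices.
\<close>

section \<open>Adjacency and switches\<close>

abbreviation adj :: "'a ugraph \<Rightarrow> 'a \<Rightarrow> 'a \<Rightarrow> bool" where
  "adj G u w \<equiv> {u, w} \<in> edges G"

abbreviation switch :: "'a \<Rightarrow> 'a \<Rightarrow> 'a \<Rightarrow> 'a \<Rightarrow> 'a set set \<times> 'a set set" where
  "switch a b x y \<equiv> ({{a, b}, {x, y}}, {{a, x}, {b, y}})"

lemma adj_commute: "adj G u w \<longleftrightarrow> adj G w u"
  by (simp add: insert_commute)

lemma simple_graph_adjD:
  assumes "simple_graph G" "adj G u w"
  shows "u \<in> verts G" "w \<in> verts G" "u \<noteq> w"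
proof -
  have "{u, w} \<subseteq> verts G" "card {u, w} = 2"
    using assms by (auto simp: simple_graph_def)
  then show "u \<in> verts G" "w \<in> verts G" "u \<noteq> w" by auto
qed

lemma not_adj_self: "simple_graph G \<Longrightarrow> \<not> adj G u u"
  using simple_graph_adjD(3) by metis

lemma can_switch_verts:
  assumes "simple_graph G" "can_switch G a b x y"
  shows "{a, b, x, y} \<subseteq> verts G"
  using assms(2) simple_graph_adjD(1,2)[OF assms(1)] unfolding can_switch_def by blast

lemma switchI: "can_switch G a b x y \<Longrightarrow> switch a b x y \<in> two_switches G"
  unfolding two_switches_def by blast

lemma finite_two_switches:
  assumes "simple_graph G"
  shows "finite (two_switches G)"
proof (rule finite_subset)
  show "two_switches G \<subseteq> Pow (Pow (verts G)) \<times> Pow (Pow (verts G))"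
  proof
    fix t assume "t \<in> two_switches G"
    then obtain a b x y where t: "t = switch a b x y" and s: "can_switch G a b x y"
      unfolding two_switches_def by blast
    then show "t \<in> Pow (Pow (verts G)) \<times> Pow (Pow (verts G))"
      using can_switch_verts[OF assms s] by simp
  qed
  show "finite (Pow (Pow (verts G)) \<times> Pow (Pow (verts G)))"
    using assms by (simp add: simple_graph_def)
qed

text \<open>All lower bounds on the degree below are obtained from explicit lists of switches.\<close>

lemma length_le_two_switch_degree:
  assumes "simple_graph G" "distinct L" "set L \<subseteq> two_switches G"
  shows "length L \<le> two_switch_degree G"
  using card_mono[OF finite_two_switches[OF assms(1)] assms(3)] distinct_card[OF assms(2)]
  by (simp add: two_switch_degree_def)

section \<open>Complementation\<close>

lemma verts_complement [simp]: "verts (complement G) = verts G"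
  by (simp add: complement_def)

lemma adj_complement:
  "adj (complement G) u w \<longleftrightarrow> u \<in> verts G \<and> w \<in> verts G \<and> u \<noteq> w \<and> \<not> adj G u w"
  by (auto simp: complement_def card_insert_if)

lemma simple_graph_complement: "simple_graph G \<Longrightarrow> simple_graph (complement G)"
  by (auto simp: simple_graph_def complement_def)

lemma complement_complement: "simple_graph G \<Longrightarrow> complement (complement G) = G"
  by (cases G) (auto simp: simple_graph_def complement_def)

lemma graph_iso_complement:
  assumes "graph_iso G H"
  shows "graph_iso (complement G) (complement H)"
proof -
  obtain f where f: "bij_betw f (verts G) (verts H)"
    and e: "\<forall>u\<in>verts G. \<forall>w\<in>verts G. adj G u w \<longleftrightarrow> adj H (f u) (f w)"
    using assms unfolding graph_iso_def by blast
  have "adj (complement G) u w \<longleftrightarrow> adj (complement H) (f u) (f w)"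
    if "u \<in> verts G" "w \<in> verts G" for u w
    using that e f unfolding adj_complement
    by (metis bij_betwE bij_betw_inv_into_left)
  then show ?thesis
    using f unfolding graph_iso_def by auto
qed

text \<open>The alternating 4-cycle of a switch has its edges and non-edges exchanged, which amounts to
  exchanging \<open>b\<close> and \<open>x\<close>.\<close>

lemma can_switch_complement:
  assumes "simple_graph G"
  shows "can_switch (complement G) a b x y \<longleftrightarrow> can_switch G a x b y"
proof
  assume "can_switch (complement G) a b x y"
  then show "can_switch G a x b y"
    unfolding can_switch_def adj_complement by auto
next
  assume s: "can_switch G a x b y"
  then have "{a, x, b, y} \<subseteq> verts G" by (rule can_switch_verts[OF assms])
  with s show "can_switch (complement G) a b x y"
    unfolding can_switch_def adj_complement by auto
qed

lemma two_switches_complement: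
  assumes "simple_graph G"
  shows "two_switches (complement G) = prod.swap ` two_switches G"
proof -
  have "(p, q) \<in> two_switches (complement G) \<longleftrightarrow> (q, p) \<in> two_switches G" for p q
    unfolding two_switches_def can_switch_complement[OF assms] by simp blast
  then show ?thesis
    by (simp add: set_eq_iff split_paired_All)
qed

lemma two_switch_degree_complement:
  "simple_graph G \<Longrightarrow> two_switch_degree (complement G) = two_switch_degree G"
  by (simp add: two_switch_degree_def two_switches_complement card_image)

lemma active_graph_complement:
  assumes "simple_graph G"
  shows "active_graph (complement G) \<longleftrightarrow> active_graph G"
proof -
  have "active_vertex (complement G) v \<longleftrightarrow> active_vertex G v" for v
    unfolding active_vertex_def can_switch_complement[OF assms] by blast
  then show ?thesis by (simp add: active_graph_def)
qed

lemma clique_complement: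
  assumes "simple_graph G" "A \<subseteq> verts G"
  shows "clique (complement G) A \<longleftrightarrow> independent G A"
  using assms(2) not_adj_self[OF assms(1)]
  unfolding clique_def independent_def adj_complement by (metis subsetD)

lemma independent_complement:
  assumes "simple_graph G" "A \<subseteq> verts G"
  shows "independent (complement G) A \<longleftrightarrow> clique G A"
  using assms(2) unfolding clique_def independent_def adj_complement by blast

lemma split_graph_complement:
  assumes "simple_graph G" "split_graph G"
  shows "split_graph (complement G)"
proof -
  obtain K I where "split_bipartition G K I"
    using assms(2) by (auto simp: split_graph_def)
  then have "split_bipartition (complement G) I K"
    using clique_complement[OF assms(1), of I] independent_complement[OF assms(1), of K]
    by (auto simp: split_bipartition_def)
  then show ?thesis by (auto simp: split_graph_def)
qed

section \<open>Tyshkevich decompositions\<close>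

text \<open>This form speaks only of adjacencies within \<open>G\<close>: the two factors are the subgraphs that
  \<open>K \<union> I\<close> and \<open>W\<close> induce. It is symmetric under complementation, with \<open>K\<close> and \<open>I\<close> exchanged.\<close>

lemma decomposable_iff:
  assumes "simple_graph G"
  shows "decomposable G \<longleftrightarrow>
    (\<exists>K I W. K \<union> I \<union> W = verts G \<and> K \<inter> I = {} \<and> (K \<union> I) \<inter> W = {} \<and> K \<union> I \<noteq> {} \<and> W \<noteq> {} \<and>
       clique G K \<and> independent G I \<and>
       (\<forall>w\<in>W. (\<forall>k\<in>K. adj G k w) \<and> (\<forall>i\<in>I. \<not> adj G i w)))"
    (is "_ \<longleftrightarrow> (\<exists>K I W. ?P K I W)")
proof
  assume "decomposable G"
  then obtain S K I H where S: "simple_graph S" "split_bipartition S K I" "simple_graph H"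
    and disj: "verts S \<inter> verts H = {}" and G: "G = tyshkevich S K H"
    unfolding decomposable_def by blast
  have adjG: "adj G u w \<longleftrightarrow> adj S u w \<or> adj H u w \<or>
      u \<in> K \<and> w \<in> verts H \<or> w \<in> K \<and> u \<in> verts H" for u w
    unfolding G tyshkevich_def by (auto simp: doubleton_eq_iff)
  have KI: "K \<union> I = verts S" "K \<inter> I = {}" "clique S K" "independent S I"
    using S(2) by (auto simp: split_bipartition_def)
  have "verts S \<noteq> {}" "verts H \<noteq> {}" using S by (auto simp: simple_graph_def)
  moreover have "clique G K" using KI(3) by (auto simp: clique_def adjG)
  moreover have "independent G I"
    using KI disj simple_graph_adjD(1)[OF S(3)] unfolding independent_def adjG by blast
  moreover have "\<forall>w\<in>verts H. (\<forall>k\<in>K. adj G k w) \<and> (\<forall>i\<in>I. \<not> adj G i w)"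
    using KI disj simple_graph_adjD(1,2)[OF S(3)] simple_graph_adjD(1,2)[OF S(1)]
    unfolding adjG by blast
  moreover have "verts G = verts S \<union> verts H" by (simp add: G tyshkevich_def)
  ultimately have "?P K I (verts H)" using KI disj by auto
  then show "\<exists>K I W. ?P K I W" by blast
next
  assume "\<exists>K I W. ?P K I W"
  then obtain K I W where P: "?P K I W" by blast
  define S where "S = \<lparr>verts = K \<union> I, edges = {e \<in> edges G. e \<subseteq> K \<union> I}\<rparr>"
  define H where "H = \<lparr>verts = W, edges = {e \<in> edges G. e \<subseteq> W}\<rparr>"
  have "simple_graph S" "simple_graph H"
    using assms P finite_subset[of W "verts G"] finite_subset[of "K \<union> I" "verts G"]
    by (auto simp: S_def H_def simple_graph_def simp del: finite_Un)
  moreover have "split_bipartition S K I"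
    using P unfolding S_def split_bipartition_def clique_def independent_def by auto
  moreover have "verts S \<inter> verts H = {}"
    using P by (simp add: S_def H_def)
  moreover have "edges G = edges S \<union> edges H \<union> {{x, y} | x y. x \<in> K \<and> y \<in> W}" (is "_ = ?R")
  proof (intro equalityI subsetI)
    fix e assume e: "e \<in> edges G"
    then obtain u w where uw: "e = {u, w}"
      using assms unfolding simple_graph_def card_2_iff by metis
    then have "u \<in> verts G" "w \<in> verts G" using e assms simple_graph_adjD by auto
    then consider "{u, w} \<subseteq> K \<union> I" | "{u, w} \<subseteq> W" | "u \<in> K \<union> I" "w \<in> W" | "w \<in> K \<union> I" "u \<in> W"
      using P by auto
    then show "e \<in> ?R"
    proof cases
      case 3
      then have "u \<in> K" using P e uw by blast
      then show ?thesis using 3 uw by blast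
    next
      case 4
      then have "w \<in> K" using P e uw by (metis Un_iff adj_commute)
      then show ?thesis using 4 uw by blast
    qed (use e uw in \<open>auto simp: S_def H_def\<close>)
  next
    fix e assume "e \<in> ?R"
    then show "e \<in> edges G" using P by (auto simp: S_def H_def)
  qed
  then have "G = tyshkevich S K H"
    using P by (cases G) (simp add: tyshkevich_def S_def H_def)
  ultimately show "decomposable G" unfolding decomposable_def by blast
qed

lemma decomposable_complement:
  assumes "simple_graph G" "decomposable G"
  shows "decomposable (complement G)"
proof -
  obtain K I W where P: "K \<union> I \<union> W = verts G" "K \<inter> I = {}" "(K \<union> I) \<inter> W = {}" "K \<union> I \<noteq> {}"
      "W \<noteq> {}" "clique G K" "independent G I"
      "\<forall>w\<in>W. (\<forall>k\<in>K. adj G k w) \<and> (\<forall>i\<in>I. \<not> adj G i w)"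
    using assms(2) unfolding decomposable_iff[OF assms(1)] by blast
  have "clique (complement G) I" "independent (complement G) K"
    using P clique_complement[OF assms(1), of I] independent_complement[OF assms(1), of K] by auto
  moreover have "\<forall>w\<in>W. (\<forall>k\<in>I. adj (complement G) k w) \<and> (\<forall>i\<in>K. \<not> adj (complement G) i w)"
    using P unfolding adj_complement by blast
  ultimately show ?thesis
    unfolding decomposable_iff[OF simple_graph_complement[OF assms(1)]]
    using P by (intro exI[of _ I] exI[of _ K] exI[of _ W])
      (simp add: Un_commute[of I K] Int_commute[of I K])
qed

lemma prime_graph_complement:
  assumes "simple_graph G" "prime_graph G"
  shows "prime_graph (complement G)"
proof -
  have "\<not> decomposable (complement G)"
    using assms decomposable_complement[OF simple_graph_complement[OF assms(1)]]
    by (auto simp: prime_graph_def complement_complement)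
  then show ?thesis
    using assms by (simp add: prime_graph_def active_graph_complement)
qed

lemma can_switch_sym:
  assumes "can_switch G a b x y"
  shows "can_switch G b a y x" "can_switch G x y a b" "can_switch G y x b a"
  using assms by (auto simp: can_switch_def insert_commute)

text \<open>Walk along the alternating 4-cycle \<open>a b y x\<close> from a vertex of \<open>W\<close>. An edge can leave \<open>W\<close> only
  into \<open>K\<close> and a non-edge only into \<open>I\<close>; from there on each edge leads from \<open>I\<close> to \<open>K\<close> and each
  non-edge from \<open>K\<close> to \<open>I\<close>, so that the walk cannot close up in \<open>W\<close>.\<close>

lemma switch_within_factor:
  assumes "can_switch G a b x y" "{a, b, x, y} \<subseteq> K \<union> I \<union> W" "clique G K" "independent G I"
    and W: "\<forall>w\<in>W. (\<forall>k\<in>K. adj G k w) \<and> (\<forall>i\<in>I. \<not> adj G i w)"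
  shows "{a, b, x, y} \<subseteq> W \<or> {a, b, x, y} \<inter> W = {}"
proof -
  have *: "{b, x, y} \<subseteq> W"
    if s: "can_switch G a b x y" and sub: "{a, b, x, y} \<subseteq> K \<union> I \<union> W" and a: "a \<in> W"
    for a b x y
  proof -
    have e: "adj G a b" "adj G b a" "adj G x y" "adj G y x" "a \<noteq> x" "b \<noteq> y"
      and n: "\<not> adj G a x" "\<not> adj G x a" "\<not> adj G b y" "\<not> adj G y b"
      using s by (auto simp: can_switch_def insert_commute)
    \<comment> \<open>Start along the edge \<open>a b\<close>, then along the non-edge \<open>a x\<close>.\<close>
    have "b \<in> W"
    proof (rule ccontr)
      assume "b \<notin> W"
      then have "b \<in> K" using sub e W a by blast
      then have "y \<in> I" using sub e n W assms(3) by (auto simp: clique_def)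
      then have "x \<in> K" using sub e W assms(4) by (auto simp: independent_def)
      then show False using W a n by blast
    qed
    moreover have "x \<in> W"
    proof (rule ccontr)
      assume "x \<notin> W"
      then have "x \<in> I" using sub n W a by blast
      then have "y \<in> K" using sub e W assms(4) by (auto simp: independent_def)
      then have "b \<in> I" using sub n e W assms(3) by (auto simp: clique_def)
      then show False using W a e by blast
    qed
    moreover have "y \<in> W" using sub e n W calculation by blast
    ultimately show ?thesis by blast
  qed
  show ?thesis
    using *[of a b x y] *[of b a y x] *[of x y a b] *[of y x b a] assms(1,2)
      can_switch_sym[OF assms(1)] by blast
qed

section \<open>Split graphs\<close>

definition induced_C4 :: "'a ugraph \<Rightarrow> 'a \<Rightarrow> 'a \<Rightarrow> 'a \<Rightarrow> 'a \<Rightarrow> bool" where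
  "induced_C4 G a b c d \<longleftrightarrow> distinct [a, b, c, d] \<and>
     adj G a b \<and> adj G b c \<and> adj G c d \<and> adj G d a \<and> \<not> adj G a c \<and> \<not> adj G b d"

definition induced_C5 :: "'a ugraph \<Rightarrow> 'a \<Rightarrow> 'a \<Rightarrow> 'a \<Rightarrow> 'a \<Rightarrow> 'a \<Rightarrow> bool" where
  "induced_C5 G a b c d e \<longleftrightarrow> distinct [a, b, c, d, e] \<and>
     adj G a b \<and> adj G b c \<and> adj G c d \<and> adj G d e \<and> adj G e a \<and>
     \<not> adj G a c \<and> \<not> adj G b d \<and> \<not> adj G c e \<and> \<not> adj G d a \<and> \<not> adj G e b"

lemma induced_C4_rotate: "induced_C4 G a b c d \<Longrightarrow> induced_C4 G b c d a"
  by (auto simp: induced_C4_def insert_commute)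

lemma induced_C4_verts:
  assumes "simple_graph G" "induced_C4 G a b c d"
  shows "{a, b, c, d} \<subseteq> verts G"
  using assms(2) simple_graph_adjD(1)[OF assms(1)] unfolding induced_C4_def by blast

lemma induced_C4_not_split:
  assumes "simple_graph G" "induced_C4 G a b c d"
  shows "\<not> split_graph G"
proof
  assume "split_graph G"
  then obtain K I where KI: "K \<union> I = verts G" "clique G K" "independent G I"
    by (auto simp: split_graph_def split_bipartition_def)
  have "a \<in> I \<or> c \<in> I" "b \<in> I \<or> d \<in> I"
    using KI assms(2) induced_C4_verts[OF assms] by (auto simp: clique_def induced_C4_def)
  then show False
    using KI(3) assms(2) unfolding independent_def induced_C4_def
    by (metis adj_commute)
qed

lemma clique_insert:
  assumes "clique G K" "\<forall>k\<in>K. adj G x k"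
  shows "clique G (insert x K)"
  using assms adj_commute unfolding clique_def by fast

lemma clique_subset: "clique G K \<Longrightarrow> L \<subseteq> K \<Longrightarrow> clique G L"
  unfolding clique_def by blast

text \<open>The theorem of Foeldes and Hammer; an induced \<open>2K\<^sub>2\<close> appears as a 4-cycle in the complement.
  Among the cliques of maximum size take \<open>K\<close> with the largest sum of degrees. If \<open>x y\<close> is an edge
  outside \<open>K\<close>, then the neighbourhoods of \<open>x\<close> and \<open>y\<close> in \<open>K\<close> are nested (else there is a \<open>C\<^sub>4\<close>), and
  the one with more neighbours, \<open>x\<close> say, misses just one vertex \<open>z\<close> of \<open>K\<close> (else there is a
  \<open>2K\<^sub>2\<close>). So \<open>x\<close> may replace \<open>z\<close> in \<open>K\<close>. Since \<open>K\<close> has maximum size, \<open>y\<close> misses a second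
  vertex \<open>w\<close> of \<open>K\<close>; since its degree sum is largest, \<open>z\<close> has a neighbour \<open>t\<close> that is not
  adjacent to \<open>x\<close>. These five vertices contain one of the forbidden subgraphs.\<close>

lemma not_split_induced_cycle:
  assumes G: "simple_graph G" and ns: "\<not> split_graph G"
  shows "(\<exists>a b c d. induced_C4 G a b c d) \<or> (\<exists>a b c d. induced_C4 (complement G) a b c d) \<or>
    (\<exists>a b c d e. induced_C5 G a b c d e)"
proof (rule ccontr)
  assume none: "\<not> ?thesis"
  have adj_neq: "u \<noteq> w" if "adj G u w" for u w
    using simple_graph_adjD(3)[OF G that] .
  have sym: "adj G w u" if "adj G u w" for u w
    using that by (simp add: insert_commute)
  have C4: False if "adj G a b" "adj G b c" "adj G c d" "adj G d a" "\<not> adj G a c" "\<not> adj G b d"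
      "a \<noteq> c" "b \<noteq> d" for a b c d
  proof -
    have "distinct [a, b, c, d]" using that(1-4)[THEN adj_neq] that(7,8) by auto
    then have "induced_C4 G a b c d" using that unfolding induced_C4_def by blast
    then show False using none by blast
  qed
  have twoK2: False if "adj G x y" "adj G z t"
      "\<not> adj G x z" "\<not> adj G x t" "\<not> adj G y z" "\<not> adj G y t" for x y z t
  proof -
    have "{x, y, z, t} \<subseteq> verts G"
      using simple_graph_adjD(1,2)[OF G that(1)] simple_graph_adjD(1,2)[OF G that(2)] by simp
    moreover have "distinct [x, z, y, t]"
      using that(1,2)[THEN adj_neq] that by (auto simp: insert_commute)
    ultimately have "induced_C4 (complement G) x z y t"
      using that unfolding induced_C4_def adj_complement by (auto simp: insert_commute)
    then show False using none by blast
  qed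
  let ?V = "verts G"
  define deg where "deg u = card {w. adj G u w}" for u
  have fV: "finite ?V" using G by (simp add: simple_graph_def)
  have fN: "finite {w. adj G u w}" for u
    using finite_subset[OF _ fV, of "{w. adj G u w}"] simple_graph_adjD(2)[OF G] by blast
  obtain K0 where K0: "K0 \<subseteq> ?V" "clique G K0"
    and K0max: "\<And>L. L \<subseteq> ?V \<Longrightarrow> clique G L \<Longrightarrow> card L \<le> card K0"
  proof -
    have "\<exists>L. (L \<subseteq> ?V \<and> clique G L) \<and> (\<forall>M. M \<subseteq> ?V \<and> clique G M \<longrightarrow> card M \<le> card L)"
      using card_mono[OF fV]
      by (intro ex_has_greatest_nat[where k = "{}" and b = "Suc (card ?V)"])
        (auto simp: clique_def less_Suc_eq_le)
    then show thesis using that by blast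
  qed
  obtain K where K: "K \<subseteq> ?V" "clique G K" "card K = card K0"
    and Kmax: "\<And>L. L \<subseteq> ?V \<Longrightarrow> clique G L \<Longrightarrow> card L = card K0 \<Longrightarrow> sum deg L \<le> sum deg K"
  proof -
    have "\<exists>L. (L \<subseteq> ?V \<and> clique G L \<and> card L = card K0) \<and>
        (\<forall>M. M \<subseteq> ?V \<and> clique G M \<and> card M = card K0 \<longrightarrow> sum deg M \<le> sum deg L)"
      using K0 sum_mono2[OF fV, of _ deg]
      by (intro ex_has_greatest_nat[where k = K0 and b = "Suc (sum deg ?V)"])
        (auto simp: less_Suc_eq_le)
    then show thesis using that by blast
  qed
  have fK: "finite K" using K(1) fV finite_subset by blast
  have "\<not> independent G (?V - K)"
  proof
    assume "independent G (?V - K)"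
    then have "split_bipartition G K (?V - K)"
      using K(1,2) by (auto simp: split_bipartition_def)
    then show False using ns by (auto simp: split_graph_def)
  qed
  then obtain x0 y0 where xy0: "x0 \<in> ?V - K" "y0 \<in> ?V - K" "adj G x0 y0"
    unfolding independent_def by blast
  \<comment> \<open>The neighbourhoods in \<open>K\<close> are nested; \<open>x\<close> and \<open>y\<close> name the two ends accordingly.\<close>
  have "(\<forall>k\<in>K. adj G y0 k \<longrightarrow> adj G x0 k) \<or> (\<forall>k\<in>K. adj G x0 k \<longrightarrow> adj G y0 k)"
  proof (rule ccontr)
    assume "\<not> ?thesis"
    then obtain p q where pq: "p \<in> K" "q \<in> K"
        "adj G y0 p" "\<not> adj G x0 p" "adj G x0 q" "\<not> adj G y0 q"
      by blast
    then have "adj G p q" using K(2) unfolding clique_def by metis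
    moreover have "adj G q x0" using pq(5) by (simp add: insert_commute)
    ultimately show False using C4[of x0 y0 p q] xy0 pq by blast
  qed
  then obtain x y where xy: "x \<in> ?V - K" "y \<in> ?V - K" "adj G x y"
    and nested: "\<And>k. k \<in> K \<Longrightarrow> adj G y k \<Longrightarrow> adj G x k"
  proof -
    have "adj G y0 x0" using xy0(3) by (simp add: insert_commute)
    then show thesis using that[of x0 y0] that[of y0 x0] xy0 \<open>_ \<or> _\<close> by blast
  qed
  have "\<not> (\<forall>k\<in>K. adj G x k)"
  proof
    assume "\<forall>k\<in>K. adj G x k"
    then have "card (insert x K) \<le> card K0"
      using K0max clique_insert[OF K(2)] xy(1) K(1) by auto
    then show False using K(3) xy(1) fK by simp
  qed
  then obtain z where z: "z \<in> K" "\<not> adj G x z" by blast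
  then have yz: "\<not> adj G y z" using nested by blast
  have xK: "adj G x k" if "k \<in> K" "k \<noteq> z" for k
  proof (rule ccontr)
    assume "\<not> adj G x k"
    moreover from this have "\<not> adj G y k" using nested that(1) by blast
    moreover have "adj G z k" using K(2) z(1) that unfolding clique_def by metis
    ultimately show False using twoK2[OF xy(3) _ z(2) _ yz] by blast
  qed
  \<comment> \<open>The competitor of \<open>K\<close>, both for size (together with \<open>y\<close>) and for degree sum.\<close>
  define K' where "K' = insert x (K - {z})"
  have K': "K' \<subseteq> ?V" "clique G K'" "card K' = card K0"
  proof -
    show "K' \<subseteq> ?V" using xy(1) K(1) unfolding K'_def by auto
    show "clique G K'"
      unfolding K'_def using clique_subset[OF K(2)] xK by (intro clique_insert) auto
    show "card K' = card K0"
      unfolding K'_def using xy(1) K(3) card_Suc_Diff1[OF fK z(1)] fK by simp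
  qed
  obtain w where w: "w \<in> K" "w \<noteq> z" "\<not> adj G y w"
  proof (rule ccontr)
    assume "\<not> thesis"
    then have "\<forall>k\<in>K'. adj G y k"
      using that sym[OF xy(3)] unfolding K'_def by blast
    then have "card (insert y K') \<le> card K0"
      using K0max clique_insert[OF K'(2)] xy(2) K'(1) by auto
    moreover have "y \<notin> K'" "finite K'"
      using xy(2) adj_neq[OF xy(3)] fK unfolding K'_def by auto
    ultimately show False using K'(3) by simp
  qed
  have "deg x \<le> deg z"
    using Kmax[OF K'] sum.remove[OF fK z(1), of deg] xy(1) fK unfolding K'_def by simp
  have "\<not> {t. adj G z t} \<subseteq> {t. adj G x t}"
  proof
    assume "{t. adj G z t} \<subseteq> {t. adj G x t}"
    then have "{t. adj G z t} \<subset> {t. adj G x t}"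
      using xy(3) yz sym by blast
    then have "deg z < deg x" unfolding deg_def by (rule psubset_card_mono[OF fN])
    then show False using \<open>deg x \<le> deg z\<close> by simp
  qed
  then obtain t where t: "adj G z t" "\<not> adj G x t" by blast
  have ty: "adj G t y"
    using twoK2[OF xy(3) t(1) z(2) t(2) yz] sym by blast
  have tx: "t \<noteq> x" using t(1) z(2) sym by blast
  have tz: "t \<noteq> z" using adj_neq[OF t(1)] by blast
  have tK: "t \<notin> K" using xK t(2) tz by blast
  have zw: "adj G z w" using K(2) z(1) w unfolding clique_def by metis
  have xw: "adj G x w" using xK w by blast
  show False
  proof (cases "adj G w t")
    case True
    have "\<not> adj G w y" using w(3) sym by blast
    then show False
      using C4[of w x y t] sym[OF xw] xy(3) sym[OF ty] sym[OF True] t(2) tx w(1) xy(2) by blast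
  next
    case False
    have "distinct [x, y, t, z, w]"
      using xy adj_neq[OF xy(3)] tx tz adj_neq[OF ty] tK z(1) w(1,2) by auto
    moreover have "\<not> adj G w y" using w(3) sym by blast
    ultimately have "induced_C5 G x y t z w"
      unfolding induced_C5_def
      using xy(3) sym[OF ty] sym[OF t(1)] zw sym[OF xw] t(2) yz False z(2) sym by blast
    then show False using none by blast
  qed
qed

section \<open>Switches around an induced 4-cycle\<close>

lemma induced_C4_can_switch:
  assumes "induced_C4 G a b c d"
  shows "can_switch G a b c d" "can_switch G b c d a"
  using assms by (auto simp: can_switch_def induced_C4_def insert_commute)

text \<open>Each of the five induced paths contributes a switch.\<close>

lemma induced_C5_degree:
  assumes "simple_graph G" "induced_C5 G a b c d e"
  shows "two_switch_degree G \<ge> 5"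
proof -
  let ?L = "[switch a b c d, switch b c d e, switch c d e a, switch d e a b, switch e a b c]"
  have "distinct ?L"
    using assms(2) by (auto simp: induced_C5_def doubleton_eq_iff)
  moreover have "can_switch G a b c d" "can_switch G b c d e" "can_switch G c d e a"
      "can_switch G d e a b" "can_switch G e a b c"
    using assms(2) by (auto simp: can_switch_def induced_C5_def insert_commute)
  then have "set ?L \<subseteq> two_switches G" by (simp add: switchI)
  ultimately have "length ?L \<le> two_switch_degree G"
    by (rule length_le_two_switch_degree[OF assms(1)])
  then show ?thesis by simp
qed

text \<open>Any two of the vertices \<open>b\<close>, \<open>d\<close>, \<open>v\<close> form an induced 4-cycle with \<open>a\<close> and \<open>c\<close>; three such cycles
  give six switches, of which five are listed.\<close>

lemma induced_K23_degree:
  assumes "simple_graph G" "induced_C4 G a b c d" "v \<notin> {a, b, c, d}"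
    and "adj G v a" "\<not> adj G v b" "adj G v c" "\<not> adj G v d"
  shows "two_switch_degree G \<ge> 5"
proof -
  have 1: "induced_C4 G a b c v" "induced_C4 G a v c d"
    using assms(2-) by (auto simp: induced_C4_def insert_commute)
  let ?L = "[switch a b c d, switch b c d a, switch a b c v, switch b c v a, switch a v c d]"
  have "distinct ?L"
    using assms(2,3) by (auto simp: induced_C4_def doubleton_eq_iff)
  moreover have "set ?L \<subseteq> two_switches G"
    using induced_C4_can_switch[OF assms(2)] induced_C4_can_switch[OF 1(1)]
      induced_C4_can_switch[OF 1(2)] by (auto intro!: switchI)
  ultimately have "length ?L \<le> two_switch_degree G"
    by (rule length_le_two_switch_degree[OF assms(1)])
  then show ?thesis by simp
qed

text \<open>The edge \<open>u w\<close> forms an induced \<open>2K\<^sub>2\<close> with each edge of the cycle.\<close>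

lemma induced_C4_plus_edge_degree:
  assumes "simple_graph G" "induced_C4 G a b c d" "adj G u w"
    and "\<forall>q\<in>{a, b, c, d}. \<not> adj G u q \<and> \<not> adj G w q"
  shows "two_switch_degree G \<ge> 5"
proof -
  have d: "u \<noteq> w" "u \<notin> {a, b, c, d}" "w \<notin> {a, b, c, d}"
    using assms(2-) not_adj_self[OF assms(1)] adj_commute[of G] unfolding induced_C4_def by blast+
  let ?L = "[switch u w a b, switch u w b c, switch u w c d, switch u w d a, switch a b c d]"
  have "distinct ?L"
    using assms(2) d by (auto simp: induced_C4_def doubleton_eq_iff)
  moreover have "can_switch G u w a b" "can_switch G u w b c" "can_switch G u w c d"
      "can_switch G u w d a"
    using assms(2-) d by (auto simp: can_switch_def induced_C4_def insert_commute)
  then have "set ?L \<subseteq> two_switches G"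
    using induced_C4_can_switch(1)[OF assms(2)] by (simp add: switchI)
  ultimately have "length ?L \<le> two_switch_degree G"
    by (rule length_le_two_switch_degree[OF assms(1)])
  then show ?thesis by simp
qed

text \<open>Any two of the three non-adjacent pairs \<open>a c\<close>, \<open>b d\<close>, \<open>u w\<close> form an induced 4-cycle.\<close>

lemma induced_octahedron_degree:
  assumes "simple_graph G" "induced_C4 G a b c d" "u \<noteq> w" "\<not> adj G u w"
    and "\<forall>q\<in>{a, b, c, d}. adj G u q \<and> adj G w q"
  shows "two_switch_degree G \<ge> 5"
proof -
  have d: "u \<notin> {a, b, c, d}" "w \<notin> {a, b, c, d}"
    using assms(5) not_adj_self[OF assms(1)] by blast+
  have 1: "induced_C4 G u a w c" "induced_C4 G u b w d"
    using assms(2-) d by (auto simp: induced_C4_def insert_commute)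
  let ?L = "[switch a b c d, switch b c d a, switch u a w c, switch a w c u, switch u b w d]"
  have "distinct ?L"
    using assms(2,3) d by (auto simp: induced_C4_def doubleton_eq_iff)
  moreover have "set ?L \<subseteq> two_switches G"
    using induced_C4_can_switch[OF assms(2)] induced_C4_can_switch[OF 1(1)]
      induced_C4_can_switch[OF 1(2)] by (simp add: switchI)
  ultimately have "length ?L \<le> two_switch_degree G"
    by (rule length_le_two_switch_degree[OF assms(1)])
  then show ?thesis by simp
qed

section \<open>The graphs with one vertex attached to a 4-cycle\<close>

definition induced_B :: "'a ugraph \<Rightarrow> nat \<Rightarrow> 'a \<Rightarrow> 'a \<Rightarrow> 'a \<Rightarrow> 'a \<Rightarrow> 'a \<Rightarrow> bool" where
  "induced_B G j c0 c1 c2 c3 v \<longleftrightarrow> j \<in> {1, 2, 3} \<and> induced_C4 G c0 c1 c2 c3 \<and>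
     v \<notin> {c0, c1, c2, c3} \<and> adj G v c0 \<and> (adj G v c1 \<longleftrightarrow> 1 < j) \<and> (adj G v c2 \<longleftrightarrow> 2 < j) \<and>
     \<not> adj G v c3"

text \<open>If \<open>v\<close> has both neighbours and non-neighbours on the cycle, then after a rotation it is
  adjacent to \<open>a\<close> but not to \<open>d\<close>. Its neighbours then form an initial
  segment of \<open>a\<close>, \<open>b\<close>, \<open>c\<close>, unless they are \<open>a\<close> and \<open>c\<close>, which gives \<open>K\<^sub>2\<^sub>,\<^sub>3\<close>.\<close>

lemma induced_C4_attachment:
  assumes "simple_graph G" "two_switch_degree G = 4" "induced_C4 G a b c d" "v \<notin> {a, b, c, d}"
  shows "(\<forall>q\<in>{a, b, c, d}. adj G v q) \<or> (\<forall>q\<in>{a, b, c, d}. \<not> adj G v q) \<or>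
    (\<exists>j c0 c1 c2 c3. induced_B G j c0 c1 c2 c3 v)"
proof -
  have *: "\<exists>j. induced_B G j a b c d v"
    if C: "induced_C4 G a b c d" and v: "v \<notin> {a, b, c, d}" "adj G v a" "\<not> adj G v d"
    for a b c d
  proof -
    have "\<not> (\<not> adj G v b \<and> adj G v c)"
      using induced_K23_degree[OF assms(1) C v(1,2) _ _ v(3)] assms(2) by auto
    then consider "\<not> adj G v b" "\<not> adj G v c" | "adj G v b" "\<not> adj G v c" | "adj G v b" "adj G v c"
      by blast
    then show ?thesis
    proof cases
      case 1
      then show ?thesis using C v by (intro exI[of _ 1]) (simp add: induced_B_def)
    next
      case 2
      then show ?thesis using C v by (intro exI[of _ 2]) (simp add: induced_B_def)
    next
      case 3
      then show ?thesis using C v by (intro exI[of _ 3]) (simp add: induced_B_def)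
    qed
  qed
  note r1 = induced_C4_rotate[OF assms(3)]
  note r2 = induced_C4_rotate[OF r1]
  note r3 = induced_C4_rotate[OF r2]
  have v: "v \<notin> {b, c, d, a}" "v \<notin> {c, d, a, b}" "v \<notin> {d, a, b, c}" using assms(4) by auto
  show ?thesis
    using *[OF assms(3,4)] *[OF r1 v(1)] *[OF r2 v(2)] *[OF r3 v(3)] by blast
qed

text \<open>The first two switches come from the 4-cycle \<open>c0 c1 c2 c3\<close>. The last two come from the paths
  \<open>v c0 c3 c2\<close> and \<open>v c0 c1 c2\<close> for \<open>j = 1\<close>, from the paths \<open>v c0 c3 c2\<close> and \<open>v c1 c2 c3\<close> for
  \<open>j = 2\<close>, and from the 4-cycle \<open>v c0 c3 c2\<close> for \<open>j = 3\<close>.\<close>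

definition B_switches ::
    "nat \<Rightarrow> 'a \<Rightarrow> 'a \<Rightarrow> 'a \<Rightarrow> 'a \<Rightarrow> 'a \<Rightarrow> ('a set set \<times> 'a set set) list" where
  "B_switches j c0 c1 c2 c3 v = [switch c0 c1 c2 c3, switch c1 c2 c3 c0] @
     (if j = 1 then [switch v c0 c3 c2, switch v c0 c1 c2]
      else if j = 2 then [switch v c0 c3 c2, switch v c1 c2 c3]
      else [switch v c0 c3 c2, switch c0 c3 c2 v])"

lemma induced_B_can_switch:
  assumes "induced_B G j c0 c1 c2 c3 v"
  shows "can_switch G v c0 c3 c2"
    and "j = 1 \<Longrightarrow> can_switch G v c0 c1 c2"
    and "j = 2 \<Longrightarrow> can_switch G v c1 c2 c3"
    and "j = 3 \<Longrightarrow> can_switch G c0 c3 c2 v"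
  using assms by (auto simp: induced_B_def can_switch_def induced_C4_def insert_commute)

lemma distinct_B_switches:
  assumes "induced_B G j c0 c1 c2 c3 v"
  shows "distinct (B_switches j c0 c1 c2 c3 v)"
proof -
  have "distinct [c0, c1, c2, c3, v]" "j = 1 \<or> j = 2 \<or> j = 3"
    using assms by (auto simp: induced_B_def induced_C4_def)
  then show ?thesis
    by (auto simp: B_switches_def doubleton_eq_iff)
qed

lemma B_switches_subset:
  assumes "induced_B G j c0 c1 c2 c3 v"
  shows "set (B_switches j c0 c1 c2 c3 v) \<subseteq> two_switches G"
proof -
  have "induced_C4 G c0 c1 c2 c3" "j = 1 \<or> j = 2 \<or> j = 3"
    using assms by (auto simp: induced_B_def)
  then show ?thesis
    using induced_B_can_switch[OF assms] induced_C4_can_switch[of G c0 c1 c2 c3]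
    by (auto simp: B_switches_def intro!: switchI)
qed

lemma B_switches_vertices:
  assumes "(D, A) \<in> set (B_switches j c0 c1 c2 c3 v)"
  shows "\<Union>D \<subseteq> {c0, c1, c2, c3, v}"
  using assms by (auto simp: B_switches_def split: if_splits)

text \<open>The four switches of the induced \<open>B\<^sub>j\<close> exhaust the degree, so every active vertex lies in it.\<close>

lemma induced_B_verts_eq:
  assumes G: "simple_graph G" "two_switch_degree G = 4" "active_graph G"
    and B: "induced_B G j c0 c1 c2 c3 v"
  shows "verts G = {c0, c1, c2, c3, v}"
proof
  have "v \<in> verts G"
    using B simple_graph_adjD(1)[OF G(1), of v c0] by (simp add: induced_B_def)
  then show "{c0, c1, c2, c3, v} \<subseteq> verts G"
    using B induced_C4_verts[OF G(1), of c0 c1 c2 c3] by (simp add: induced_B_def)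
  let ?L = "B_switches j c0 c1 c2 c3 v"
  have "card (set ?L) = 4"
    using distinct_card[OF distinct_B_switches[OF B]] by (simp add: B_switches_def)
  then have all: "set ?L = two_switches G"
    using card_subset_eq[OF finite_two_switches[OF G(1)] B_switches_subset[OF B]] G(2)
    by (simp add: two_switch_degree_def)
  show "verts G \<subseteq> {c0, c1, c2, c3, v}"
  proof
    fix w assume "w \<in> verts G"
    then obtain a b x y where s: "can_switch G a b x y" and w: "w \<in> {a, b, x, y}"
      using G(3) unfolding active_graph_def active_vertex_def by blast
    have "\<Union>{{a, b}, {x, y}} \<subseteq> {c0, c1, c2, c3, v}"
      using B_switches_vertices[of "{{a, b}, {x, y}}"] switchI[OF s] all by blast
    then show "w \<in> {c0, c1, c2, c3, v}" using w by auto
  qed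
qed

lemma two_switches_C4:
  assumes "simple_graph G" "induced_C4 G a b c d" "verts G = {a, b, c, d}"
  shows "two_switches G \<subseteq> set [switch a b c d, switch b c d a]"
proof
  fix t assume "t \<in> two_switches G"
  then obtain p q x y where t: "t = switch p q x y" and s: "can_switch G p q x y"
    unfolding two_switches_def by blast
  \<comment> \<open>A search through all quadruples, nested so that the adjacency conditions prune it early.\<close>
  have "\<forall>p\<in>verts G. \<forall>q\<in>verts G. adj G p q \<longrightarrow>
      (\<forall>x\<in>verts G. x \<noteq> p \<and> \<not> adj G p x \<longrightarrow> (\<forall>y\<in>verts G. y \<noteq> q \<and> \<not> adj G q y \<longrightarrow>
        switch p q x y \<in> set [switch a b c d, switch b c d a]))"
    using assms(2) not_adj_self[OF assms(1)] unfolding assms(3) induced_C4_def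
    by (simp add: insert_commute)
  moreover have "p \<in> verts G" "q \<in> verts G" "x \<in> verts G" "y \<in> verts G"
    using can_switch_verts[OF assms(1) s] by auto
  moreover have "adj G p q" "x \<noteq> p" "x \<noteq> q" "\<not> adj G p x"
      "y \<noteq> q" "y \<noteq> p" "adj G x y" "\<not> adj G q y"
    using s by (auto simp: can_switch_def)
  ultimately show "t \<in> set [switch a b c d, switch b c d a]"
    unfolding t by blast
qed

lemma two_switches_B:
  assumes G: "simple_graph G" and B: "induced_B G j c0 c1 c2 c3 v"
    and V: "verts G = {c0, c1, c2, c3, v}"
  shows "two_switches G \<subseteq> set (B_switches j c0 c1 c2 c3 v)"
proof
  fix t assume "t \<in> two_switches G"
  then obtain p q x y where t: "t = switch p q x y" and s: "can_switch G p q x y"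
    unfolding two_switches_def by blast
  have j: "j = 1 \<or> j = 2 \<or> j = 3" using B by (simp add: induced_B_def)
  \<comment> \<open>A search through all quadruples, nested so that the adjacency conditions prune it early.\<close>
  have "\<forall>p\<in>verts G. \<forall>q\<in>verts G. adj G p q \<longrightarrow>
      (\<forall>x\<in>verts G. x \<noteq> p \<and> x \<noteq> q \<and> \<not> adj G p x \<longrightarrow>
        (\<forall>y\<in>verts G. y \<noteq> q \<and> y \<noteq> p \<and> adj G x y \<and> \<not> adj G q y \<longrightarrow>
          switch p q x y \<in> set (B_switches j c0 c1 c2 c3 v)))"
    using B not_adj_self[OF G] j
    unfolding V induced_B_def induced_C4_def B_switches_def
    by (elim disjE) (simp_all add: insert_commute)
  moreover have "p \<in> verts G" "q \<in> verts G" "x \<in> verts G" "y \<in> verts G"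
    using can_switch_verts[OF G s] by auto
  moreover have "adj G p q" "x \<noteq> p" "x \<noteq> q" "\<not> adj G p x"
      "y \<noteq> q" "y \<noteq> p" "adj G x y" "\<not> adj G q y"
    using s by (auto simp: can_switch_def)
  ultimately show "t \<in> set (B_switches j c0 c1 c2 c3 v)"
    unfolding t by blast
qed

lemma induced_B_switch_degree:
  assumes G: "simple_graph G" and B: "induced_B G j c0 c1 c2 c3 v"
    and V: "verts G = {c0, c1, c2, c3, v}"
  shows "two_switch_degree G = 4"
proof -
  have "two_switches G = set (B_switches j c0 c1 c2 c3 v)"
    using two_switches_B[OF assms] B_switches_subset[OF B] by blast
  then show ?thesis
    using distinct_card[OF distinct_B_switches[OF B]]
    by (simp add: two_switch_degree_def B_switches_def)
qed

text \<open>The cycle \<open>c0 c1 c2 c3\<close> and the vertices \<open>v c0 c3 c2\<close> each carry a switch, and these two sets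
  overlap and cover the graph. So all its vertices are active, and they all lie in the same
  factor of a decomposition.\<close>

lemma induced_B_prime:
  assumes G: "simple_graph G" and B: "induced_B G j c0 c1 c2 c3 v"
    and V: "verts G = {c0, c1, c2, c3, v}"
  shows "prime_graph G"
proof -
  have C: "can_switch G c0 c1 c2 c3"
    using B by (intro induced_C4_can_switch(1)) (simp add: induced_B_def)
  note S = induced_B_can_switch(1)[OF B]
  have "active_graph G"
    unfolding active_graph_def active_vertex_def V
  proof
    fix w assume "w \<in> {c0, c1, c2, c3, v}"
    then have "w \<in> {c0, c1, c2, c3} \<or> w \<in> {v, c0, c3, c2}" by blast
    then show "\<exists>a b x y. can_switch G a b x y \<and> w \<in> {a, b, x, y}"
      using C S by blast
  qed
  moreover have "\<not> decomposable G"
  proof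
    assume "decomposable G"
    then obtain K I W where P: "K \<union> I \<union> W = verts G" "(K \<union> I) \<inter> W = {}" "K \<union> I \<noteq> {}" "W \<noteq> {}"
        "clique G K" "independent G I"
        "\<forall>w\<in>W. (\<forall>k\<in>K. adj G k w) \<and> (\<forall>i\<in>I. \<not> adj G i w)"
      unfolding decomposable_iff[OF G] by blast
    have "{c0, c1, c2, c3} \<subseteq> W \<or> {c0, c1, c2, c3} \<inter> W = {}"
      using switch_within_factor[OF C _ P(5-7)] P(1) V by simp
    moreover have "{v, c0, c3, c2} \<subseteq> W \<or> {v, c0, c3, c2} \<inter> W = {}"
      using switch_within_factor[OF S _ P(5-7)] P(1) V by simp
    ultimately have "verts G \<subseteq> W \<or> verts G \<inter> W = {}" unfolding V by blast
    then show False using P(1-4) by blast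
  qed
  ultimately show ?thesis by (simp add: prime_graph_def)
qed

section \<open>Isomorphism with the model graphs\<close>

lemma verts_B: "verts (B j) = {0, 1, 2, 3, 4}"
  by (simp add: B_def)

lemma adj_B:
  "adj (B j) i k \<longleftrightarrow> {i, k} \<in> {{0, 1}, {1, 2}, {2, 3}, {3, 0}} \<or> i = 4 \<and> k < j \<or> k = 4 \<and> i < j"
  by (auto simp: B_def doubleton_eq_iff)

lemma simple_graph_B:
  assumes "j \<le> 3"
  shows "simple_graph (B j)"
proof -
  have "{4, i} \<subseteq> {0, 1, 2, 3, 4} \<and> card {4, i} = 2" if "i < j" for i
  proof -
    have "i = 0 \<or> i = 1 \<or> i = 2" using that assms by linarith
    then show ?thesis by auto
  qed
  then show ?thesis unfolding simple_graph_def B_def by auto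
qed

lemma graph_iso_B_imp_induced_B:
  assumes j: "j \<in> {1, 2, 3}" and iso: "graph_iso G (B j)"
  shows "\<exists>c0 c1 c2 c3 v. verts G = {c0, c1, c2, c3, v} \<and> induced_B G j c0 c1 c2 c3 v"
proof -
  obtain f where f: "bij_betw f (verts G) {0, 1, 2, 3, 4}"
    and e: "\<And>u w. u \<in> verts G \<Longrightarrow> w \<in> verts G \<Longrightarrow> adj G u w \<longleftrightarrow> adj (B j) (f u) (f w)"
    using iso unfolding graph_iso_def verts_B by blast
  define g where "g = inv_into (verts G) f"
  have g: "bij_betw g {0, 1, 2, 3, 4} (verts G)"
    unfolding g_def using f by (rule bij_betw_inv_into)
  have V: "verts G = {g 0, g 1, g 2, g 3, g 4}"
    using g by (simp add: bij_betw_def)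
  have fg: "f (g i) = i" if "i \<in> {0, 1, 2, 3, 4}" for i
    unfolding g_def using f that by (rule bij_betw_inv_into_right)
  have adj_g: "adj G (g i) (g k) \<longleftrightarrow> adj (B j) i k"
    if "i \<in> {0, 1, 2, 3, 4}" "k \<in> {0, 1, 2, 3, 4}" for i k
    using e[of "g i" "g k"] fg[OF that(1)] fg[OF that(2)] V that by auto
  have g_eq: "g i = g k \<longleftrightarrow> i = k" if "i \<in> {0, 1, 2, 3, 4}" "k \<in> {0, 1, 2, 3, 4}" for i k
    using fg[OF that(1)] fg[OF that(2)] by metis
  have "induced_B G j (g 0) (g 1) (g 2) (g 3) (g 4)"
    using j unfolding induced_B_def induced_C4_def
    by (auto simp: adj_g adj_B g_eq doubleton_eq_iff)
  then show ?thesis using V by blast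
qed

lemma induced_B_imp_graph_iso:
  assumes G: "simple_graph G" and B: "induced_B G j c0 c1 c2 c3 v"
    and V: "verts G = {c0, c1, c2, c3, v}"
  shows "graph_iso G (B j)"
proof -
  define f where "f u = (if u = c0 then 0 else if u = c1 then 1 else if u = c2 then 2
    else if u = c3 then 3 else 4 :: nat)" for u
  have d: "distinct [c0, c1, c2, c3, v]" and j: "j = 1 \<or> j = 2 \<or> j = 3"
    using B by (auto simp: induced_B_def induced_C4_def)
  have f: "f c0 = 0" "f c1 = 1" "f c2 = 2" "f c3 = 3" "f v = 4"
    using d by (auto simp: f_def)
  have "bij_betw f (verts G) (verts (B j))"
    unfolding V verts_B by (rule bij_betw_imageI) (use f in \<open>auto simp: inj_on_def\<close>)
  moreover have "\<forall>u\<in>verts G. \<forall>w\<in>verts G. adj G u w \<longleftrightarrow> adj (B j) (f u) (f w)"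
    using B j not_adj_self[OF G] unfolding V induced_B_def induced_C4_def
    by (elim disjE) (simp_all add: f adj_B insert_commute doubleton_eq_iff)
  ultimately show ?thesis unfolding graph_iso_def by blast
qed

section \<open>The classification\<close>

lemma prime_degree_4_with_induced_C4:
  assumes G: "simple_graph G" "prime_graph G" "two_switch_degree G = 4"
    and C: "induced_C4 G a b c d"
  shows "\<exists>j\<in>{1, 2, 3}. graph_iso G (B j)"
proof (cases "\<exists>j c0 c1 c2 c3 v. induced_B G j c0 c1 c2 c3 v")
  case True
  then obtain j c0 c1 c2 c3 v where B: "induced_B G j c0 c1 c2 c3 v" by blast
  have "active_graph G" using G(2) by (simp add: prime_graph_def)
  then have "graph_iso G (B j)"
    using induced_B_imp_graph_iso[OF G(1) B] induced_B_verts_eq[OF G(1,3) _ B] by blast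
  then show ?thesis using B unfolding induced_B_def by blast
next
  case False
  \<comment> \<open>\<open>K\<close>, \<open>I\<close> and the cycle will be the parts of a decomposition. As there is no induced
    \<open>B\<^sub>j\<close>, adjacency to \<open>a\<close> decides adjacency to the whole cycle.\<close>
  let ?C = "{a, b, c, d}"
  define K where "K = {v \<in> verts G - ?C. adj G v a}"
  define I where "I = verts G - ?C - K"
  have K: "\<forall>q\<in>?C. adj G v q" if "v \<in> K" for v
    using induced_C4_attachment[OF G(1,3) C, of v] that False unfolding K_def by blast
  have I: "\<forall>q\<in>?C. \<not> adj G v q" if "v \<in> I" for v
    using induced_C4_attachment[OF G(1,3) C, of v] that False unfolding I_def K_def by blast
  have "clique G K"
    unfolding clique_def
  proof (intro ballI impI, rule ccontr)
    fix u w assume "u \<in> K" "w \<in> K" "u \<noteq> w" "\<not> adj G u w"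
    then show False
      using induced_octahedron_degree[OF G(1) C, of u w] K G(3) by simp
  qed
  moreover have "independent G I"
    unfolding independent_def
  proof (intro ballI notI)
    fix u w assume "u \<in> I" "w \<in> I" "adj G u w"
    then show False
      using induced_C4_plus_edge_degree[OF G(1) C, of u w] I G(3) by simp
  qed
  moreover have "K \<union> I \<noteq> {}"
  proof
    assume "K \<union> I = {}"
    then have "verts G = ?C"
      using induced_C4_verts[OF G(1) C] unfolding I_def by blast
    then have "card (two_switches G) \<le> card (set [switch a b c d, switch b c d a])"
      using two_switches_C4[OF G(1) C] by (intro card_mono) auto
    also have "\<dots> \<le> 2" by (rule order_trans[OF card_length]) simp
    finally show False using G(3) by (simp add: two_switch_degree_def)
  qed
  moreover have "K \<union> I \<union> ?C = verts G"
    using induced_C4_verts[OF G(1) C] unfolding I_def K_def by blast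
  moreover have "\<forall>w\<in>?C. (\<forall>k\<in>K. adj G k w) \<and> (\<forall>i\<in>I. \<not> adj G i w)"
    using K I by blast
  moreover have "K \<inter> I = {}" "(K \<union> I) \<inter> ?C = {}" "?C \<noteq> {}"
    unfolding I_def K_def by auto
  ultimately have "decomposable G"
    unfolding decomposable_iff[OF G(1)] by (intro exI[of _ K] exI[of _ I] exI[of _ ?C] conjI)
  then show ?thesis using G(2) by (simp add: prime_graph_def)
qed

lemma graph_iso_B_properties:
  assumes "simple_graph G" "j \<in> {1, 2, 3}" "graph_iso G (B j)"
  shows "prime_graph G \<and> \<not> split_graph G \<and> two_switch_degree G = 4"
proof -
  obtain c0 c1 c2 c3 v where V: "verts G = {c0, c1, c2, c3, v}" and B: "induced_B G j c0 c1 c2 c3 v"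
    using graph_iso_B_imp_induced_B[OF assms(2,3)] by blast
  have "\<not> split_graph G"
    using B induced_C4_not_split[OF assms(1)] unfolding induced_B_def by blast
  then show ?thesis
    using induced_B_prime[OF assms(1) B V] induced_B_switch_degree[OF assms(1) B V] by blast
qed

theorem theorem6p1:
  fixes G :: "'a ugraph"
  assumes "simple_graph G"
  shows "prime_graph G \<and> \<not> split_graph G \<and> two_switch_degree G = 4 \<longleftrightarrow>
    (\<exists>j\<in>{1, 2, 3}. graph_iso G (B j) \<or> graph_iso G (complement (B j)))"
proof -
  note cG = simple_graph_complement[OF assms]
  have ccG: "complement (complement G) = G"
    using assms by (rule complement_complement)
  have iso: "graph_iso G (complement (B j)) \<longleftrightarrow> graph_iso (complement G) (B j)"
    if j: "j \<in> {1, 2, 3}" for j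
  proof -
    have "complement (complement (B j)) = B j"
      using j by (intro complement_complement simple_graph_B) auto
    then show ?thesis
      using graph_iso_complement[of G "complement (B j)"]
        graph_iso_complement[of "complement G" "B j"] ccG by auto
  qed
  show ?thesis
  proof
    assume L: "prime_graph G \<and> \<not> split_graph G \<and> two_switch_degree G = 4"
    then consider (C4) a b c d where "induced_C4 G a b c d"
      | (twoK2) a b c d where "induced_C4 (complement G) a b c d"
      | (C5) a b c d e where "induced_C5 G a b c d e"
      using not_split_induced_cycle[OF assms] by blast
    then show "\<exists>j\<in>{1, 2, 3}. graph_iso G (B j) \<or> graph_iso G (complement (B j))"
    proof cases
      case C4
      then show ?thesis using prime_degree_4_with_induced_C4[OF assms] L by blast
    next
      case twoK2
      have "prime_graph (complement G)" "two_switch_degree (complement G) = 4"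
        using L prime_graph_complement[OF assms] two_switch_degree_complement[OF assms] by auto
      then show ?thesis
        using prime_degree_4_with_induced_C4[OF cG _ _ twoK2] iso by blast
    next
      case C5
      then show ?thesis using induced_C5_degree[OF assms C5] L by simp
    qed
  next
    assume "\<exists>j\<in>{1, 2, 3}. graph_iso G (B j) \<or> graph_iso G (complement (B j))"
    then obtain j where j: "j \<in> {1, 2, 3}"
      and "graph_iso G (B j) \<or> graph_iso (complement G) (B j)"
      using iso by blast
    then show "prime_graph G \<and> \<not> split_graph G \<and> two_switch_degree G = 4"
    proof (elim disjE)
      assume "graph_iso G (B j)"
      then show ?thesis by (rule graph_iso_B_properties[OF assms j])
    next
      assume "graph_iso (complement G) (B j)"
      then have "prime_graph (complement G)" "\<not> split_graph (complement G)"
          "two_switch_degree (complement G) = 4"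
        using graph_iso_B_properties[OF cG j] by auto
      then show ?thesis
        using prime_graph_complement[OF cG] split_graph_complement[OF assms]
          two_switch_degree_complement[OF assms] ccG by auto
    qed
  qed
qed

end
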